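(* $m_g(2,4)=7$.
   Context: For a prime power $q$, $\mathbb{P}^2(\mathbb{F}_q)$ is the projective plane over the field $\mathbb{F}_q$ with $q$ elements. A conic is the zero set in $\mathbb{P}^2(\mathbb{F}_q)$ of a nonzero homogeneous quadratic form over $\mathbb{F}_q$; it may be reducible (e.g. a union of two lines). A generalized $k$-arc is a set of $k$ points of $\mathbb{P}^2(\mathbb{F}_q)$ such that no six of them lie on a (possibly reducible) conic. It is complete if it is not contained in a generalized $(k+1)$-arc. $m_g(2,q)$ is the size of the largest complete generalized $k$-arc in $\mathbb{P}^2(\mathbb{F}_q)$. *)

theory Defs
  imports "HOL-Analysis.Analysis"
begin

definition proj_plane :: "('a::field ^ 3) set set" where
  "proj_plane = {vec.span {v} | v. v \<noteq> 0}"

text \<open>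
  A ternary quadratic form is given by its six coefficients, so that it makes sense in
  characteristic 2; it is nonzero iff some coefficient is nonzero.
\<close>

definition quad_form :: "'a::field \<Rightarrow> 'a \<Rightarrow> 'a \<Rightarrow> 'a \<Rightarrow> 'a \<Rightarrow> 'a \<Rightarrow> 'a ^ 3 \<Rightarrow> 'a" where
  "quad_form a b c d e f x =
     a * (x $ 1)\<^sup>2 + b * (x $ 2)\<^sup>2 + c * (x $ 3)\<^sup>2
     + d * x $ 1 * x $ 2 + e * x $ 1 * x $ 3 + f * x $ 2 * x $ 3"

definition conic :: "('a::field ^ 3) set set \<Rightarrow> bool" where
  "conic C \<longleftrightarrow> (\<exists>a b c d e f.
     \<not> (a = 0 \<and> b = 0 \<and> c = 0 \<and> d = 0 \<and> e = 0 \<and> f = 0) \<and>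
     C = {P \<in> proj_plane. \<forall>x\<in>P. quad_form a b c d e f x = 0})"

definition generalized_arc :: "nat \<Rightarrow> ('a::field ^ 3) set set \<Rightarrow> bool" where
  "generalized_arc k K \<longleftrightarrow> K \<subseteq> proj_plane \<and> finite K \<and> card K = k \<and>
     \<not> (\<exists>S C. S \<subseteq> K \<and> card S = 6 \<and> conic C \<and> S \<subseteq> C)"

definition complete_generalized_arc :: "nat \<Rightarrow> ('a::field ^ 3) set set \<Rightarrow> bool" where
  "complete_generalized_arc k K \<longleftrightarrow>
     generalized_arc k K \<and> \<not> (\<exists>L. generalized_arc (k + 1) L \<and> K \<subseteq> L)"

text \<open>
  The plane over a finite field has finitely many points and \<open>{}\<close> is a generalized arc, so the
  maximum ranges over a finite nonempty set. The argument only carries the field, written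
  \<open>TYPE('a)\<close>; the order of the field is \<open>CARD('a)\<close>.
\<close>

definition m_g :: "'a::{field,finite} itself \<Rightarrow> nat" where
  "m_g _ = Max {k. \<exists>K :: ('a ^ 3) set set. complete_generalized_arc k K}"

end

theory Submission
  imports Defs "HOL-Number_Theory.Residues"
begin

text \<open>
  Over a field of order 4 a conic with at least six points is the union of two distinct lines: a
  smooth conic and a double line have five points each, and a pair of conjugate lines has one. So a
  generalized arc is in effect a set of points of which no two lines together contain six.

  No eight points can do this. If no two lines cover six of them, then a line contains at most three
  (a line with four, together with the line through two of the others, would cover six), and two
  trisecants always meet in one of the eight points. Only five lines pass through a point, so at
  least two of them must be trisecants in order to reach the seven other points. Counting shows that
  such incidences are contradictory (\<open>two_lines_cover_six_of_eight\<close>). A union of two lines is a conic by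
  multiplying the two linear forms (\<open>conic_line_pair\<close>).

  Seven points are attained by the Fano subplane, the points with coordinates in the prime field. In
  characteristic 2 the values of a quadratic form at its seven points add up to zero
  (\<open>quad_form_sum_fano\<close>), so a form vanishing at six of them vanishes at the seventh, and then all its
  coefficients are zero (\<open>generalized_arc_fano\<close>). This arc is complete because it has the largest
  possible size.
\<close>

section \<open>Eight points in a linear space\<close>

text \<open>
  Suppose that no two lines cover six points of \<open>K\<close>. Then a line contains at most three of them. Call it
  a trisecant if it contains three; two trisecants meet in \<open>K\<close>, and every point of \<open>K\<close> is on at least two
  trisecants, because at most five lines join it to the seven other points. Fix \<open>P\<close> in \<open>K\<close> and two trisecants \<open>l\<close>, \<open>m\<close> through it;
  three points of \<open>K\<close> remain. A trisecant that avoids \<open>P\<close> meets each trisecant through \<open>P\<close> in a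
  point of \<open>K\<close>, and these points are distinct.

  If there is a third trisecant \<open>n\<close> through \<open>P\<close>, then one point \<open>G\<close> is on none of \<open>l\<close>, \<open>m\<close>, \<open>n\<close>, and a
  trisecant through \<open>G\<close> that avoids \<open>P\<close> has four points: \<open>G\<close> and one on each of the three lines.
  Otherwise write \<open>l = {P, A, B}\<close> and \<open>m = {P, C, D}\<close> on \<open>K\<close>. Both trisecants through a remaining point
  avoid \<open>P\<close>, so each contains one of \<open>A\<close>, \<open>B\<close> and one of \<open>C\<close>, \<open>D\<close>, and one of them contains \<open>A\<close>. Hence
  each of the three remaining points is on the line \<open>AC\<close> or the line \<open>AD\<close>; two of them are on the same
  line, which then has four points.
\<close>

lemma two_lines_cover_six_of_eight:
  fixes K :: "'p set" and L :: "'p set set"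
  assumes K8: "card K = 8"
    and join: "\<And>P Q. P \<in> K \<Longrightarrow> Q \<in> K \<Longrightarrow> P \<noteq> Q \<Longrightarrow> \<exists>l\<in>L. P \<in> l \<and> Q \<in> l"
    and uniq: "\<And>l m P Q. l \<in> L \<Longrightarrow> m \<in> L \<Longrightarrow> P \<in> l \<Longrightarrow> P \<in> m \<Longrightarrow> Q \<in> l \<Longrightarrow> Q \<in> m \<Longrightarrow> P \<noteq> Q \<Longrightarrow> l = m"
    and pencil_finite: "\<And>P. P \<in> K \<Longrightarrow> finite {l \<in> L. P \<in> l}"
    and pencil_card: "\<And>P. P \<in> K \<Longrightarrow> card {l \<in> L. P \<in> l} \<le> 5"
  shows "\<exists>l\<in>L. \<exists>m\<in>L. 6 \<le> card (K \<inter> (l \<union> m))"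
proof (rule ccontr)
  assume no_pair: "\<not> ?thesis"
  have fin: "finite K"
    using K8 card.infinite by fastforce
  have few: "card A \<le> 5" if "l \<in> L" "m \<in> L" "A \<subseteq> K \<inter> (l \<union> m)" for A l m
  proof -
    have "card A \<le> card (K \<inter> (l \<union> m))"
      using that fin by (intro card_mono) auto
    then show ?thesis
      using no_pair that by force
  qed
  have at_most_three: "card (K \<inter> l) \<le> 3" if l: "l \<in> L" for l
  proof (rule ccontr)
    assume "\<not> ?thesis"
    have "card (K \<inter> l) \<le> 5"
      using few[OF l l] by simp
    moreover have "card (K - l) = 8 - card (K \<inter> l)"
      using K8 fin by (simp add: card_Diff_subset_Int)
    ultimately have "2 \<le> card (K - l)"
      by simp
    then obtain B where B: "B \<subseteq> K - l" "card B = 2"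
      by (meson obtain_subset_with_card_n)
    then obtain Q R where QR: "B = {Q, R}" "Q \<noteq> R"
      by (meson card_2_iff)
    then obtain m where m: "m \<in> L" "Q \<in> m" "R \<in> m"
      using join B by (metis DiffD1 insert_subset)
    have "card ((K \<inter> l) \<union> B) = card (K \<inter> l) + 2"
      using B fin finite_subset by (subst card_Un_disjoint) auto
    moreover have "card ((K \<inter> l) \<union> B) \<le> 5"
      using B QR m by (intro few[OF l m(1)]) auto
    ultimately show False
      using \<open>\<not> card (K \<inter> l) \<le> 3\<close> by simp
  qed
  define T where "T = {l \<in> L. card (K \<inter> l) = 3}"
  have T_L: "l \<in> L" and T_card: "card (K \<inter> l) = 3" if "l \<in> T" for l
    using that by (auto simp: T_def)
  have no_four: False
    if "l \<in> T" "{W, X, Y, Z} \<subseteq> K \<inter> l" "distinct [W, X, Y, Z]" for l W X Y Z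
  proof -
    have "card {W, X, Y, Z} \<le> card (K \<inter> l)"
      using that fin by (intro card_mono) auto
    then show False
      using that T_card by auto
  qed
  have two_trisecants: "\<exists>l m. l \<in> T \<and> m \<in> T \<and> l \<noteq> m \<and> P \<in> l \<and> P \<in> m" if P: "P \<in> K" for P
  proof -
    define S where "S = {l \<in> L. P \<in> l}"
    have S: "finite S" "card S \<le> 5"
      using pencil_finite pencil_card P by (auto simp: S_def)
    have "K - {P} \<subseteq> (\<Union>l\<in>S. K \<inter> l - {P})"
    proof
      fix Q assume Q: "Q \<in> K - {P}"
      then obtain l where "l \<in> L" "P \<in> l" "Q \<in> l"
        using join[of P Q] P by auto
      then show "Q \<in> (\<Union>l\<in>S. K \<inter> l - {P})"
        using Q by (auto simp: S_def)
    qed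
    then have "card (K - {P}) \<le> card (\<Union>l\<in>S. K \<inter> l - {P})"
      using S fin by (intro card_mono) auto
    then have "7 \<le> card (\<Union>l\<in>S. K \<inter> l - {P})"
      using K8 P fin by simp
    also have "\<dots> \<le> (\<Sum>l\<in>S. card (K \<inter> l - {P}))"
      using S by (intro card_UN_le)
    \<comment> \<open>Apart from \<open>P\<close>, a trisecant contributes two points and any other line at most one.\<close>
    also have "\<dots> \<le> (\<Sum>l\<in>S. 1 + (if l \<in> T then 1 else 0))"
    proof (rule sum_mono)
      fix l assume "l \<in> S"
      then have "l \<in> L" "P \<in> K \<inter> l"
        using P by (auto simp: S_def)
      then show "card (K \<inter> l - {P}) \<le> 1 + (if l \<in> T then 1 else 0)"
        using at_most_three[of l] fin by (auto simp: T_def)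
    qed
    also have "\<dots> = card S + card (S \<inter> T)"
      using S by (simp only: sum.distrib sum.If_cases) simp
    finally have "2 \<le> card (S \<inter> T)"
      using S by simp
    then obtain B where "B \<subseteq> S \<inter> T" "card B = 2"
      by (meson obtain_subset_with_card_n)
    moreover from \<open>card B = 2\<close> obtain l m where "B = {l, m}" "l \<noteq> m"
      by (meson card_2_iff)
    ultimately show ?thesis
      unfolding S_def by blast
  qed
  have meet: "\<exists>X\<in>K. X \<in> l \<and> X \<in> m" if "l \<in> T" "m \<in> T" for l m
  proof (rule ccontr)
    assume "\<not> ?thesis"
    then have "card ((K \<inter> l) \<union> (K \<inter> m)) = 6"
      using that fin T_card by (subst card_Un_disjoint) auto
    then show False
      using few[of l m "(K \<inter> l) \<union> (K \<inter> m)"] that T_L by auto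
  qed
  have "K \<noteq> {}"
    using K8 by auto
  then obtain P where P: "P \<in> K"
    by auto
  obtain l m where lm: "l \<in> T" "m \<in> T" "l \<noteq> m" "P \<in> l" "P \<in> m"
    using two_trisecants[OF P] by blast
  have rest: "card (K - l - m) = 3"
  proof -
    have "K \<inter> l \<inter> (K \<inter> m) = {P}"
      using P lm uniq T_L by blast
    then have "card (K \<inter> l \<union> K \<inter> m) = 5"
      using card_Un_Int[of "K \<inter> l" "K \<inter> m"] fin lm T_card by simp
    moreover have "K - l - m = K - (K \<inter> l \<union> K \<inter> m)"
      by auto
    ultimately show ?thesis
      using K8 fin by (simp add: card_Diff_subset)
  qed
  show False
  proof (cases "\<exists>n\<in>T. P \<in> n \<and> n \<noteq> l \<and> n \<noteq> m")
    case True
    then obtain n where n: "n \<in> T" "P \<in> n" "n \<noteq> l" "n \<noteq> m"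
      by auto
    have "card (K \<inter> n - {P}) = 2"
      using P n T_card fin by simp
    then have "\<not> K - l - m \<subseteq> K \<inter> n - {P}"
      using rest fin card_mono[of "K \<inter> n - {P}" "K - l - m"] by auto
    then obtain G where G: "G \<in> K" "G \<notin> l" "G \<notin> m" "G \<notin> n"
      using lm by blast
    obtain g where g: "g \<in> T" "G \<in> g" "P \<notin> g"
      using two_trisecants[OF G(1)] lm G P uniq T_L by metis
    obtain X where X: "X \<in> K" "X \<in> g" "X \<in> l"
      using meet g lm by blast
    obtain Y where Y: "Y \<in> K" "Y \<in> g" "Y \<in> m"
      using meet g lm by blast
    obtain Z where Z: "Z \<in> K" "Z \<in> g" "Z \<in> n"
      using meet g n by blast
    have "X \<noteq> Y" "X \<noteq> Z" "Y \<noteq> Z"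
      using X Y Z g lm n uniq T_L by metis+
    then show False
      using no_four[OF g(1), of G X Y Z] G g X Y Z by auto
  next
    case False
    obtain A B where AB: "K \<inter> l - {P} = {A, B}" "A \<noteq> B"
      using T_card[OF lm(1)] lm P fin card_2_iff[of "K \<inter> l - {P}"] by auto
    obtain C D where CD: "K \<inter> m - {P} = {C, D}" "C \<noteq> D"
      using T_card[OF lm(2)] lm P fin card_2_iff[of "K \<inter> m - {P}"] by auto
    have AK: "A \<in> K" "A \<in> l" "A \<noteq> P"
      using AB by auto
    have CDK: "C \<in> K" "C \<in> m" "C \<noteq> P" "D \<in> K" "D \<in> m" "D \<noteq> P"
      using CD by auto
    have AC: "A \<noteq> C" "A \<noteq> D"
      using AK CDK lm uniq T_L by metis+
    have through_A: "\<exists>g\<in>T. X \<in> g \<and> A \<in> g \<and> (C \<in> g \<or> D \<in> g)" if X: "X \<in> K - l - m" for X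
    proof -
      obtain g h where gh: "g \<in> T" "h \<in> T" "g \<noteq> h" "X \<in> g" "X \<in> h"
        using two_trisecants[of X] X by auto
      have notP: "P \<notin> g" "P \<notin> h"
        using False gh X by auto
      have hit: "(A \<in> k \<or> B \<in> k) \<and> (C \<in> k \<or> D \<in> k)" if k: "k \<in> T" "P \<notin> k" for k
      proof -
        obtain V where V: "V \<in> K" "V \<in> k" "V \<in> l"
          using meet[OF k(1) lm(1)] by blast
        obtain W where W: "W \<in> K" "W \<in> k" "W \<in> m"
          using meet[OF k(1) lm(2)] by blast
        have "V \<in> {A, B}" "W \<in> {C, D}"
          using V W k(2) AB(1) CD(1) by blast+
        then show ?thesis
          using V W by blast
      qed
      have "\<not> (B \<in> g \<and> B \<in> h)"
      proof -
        have "B \<noteq> X"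
          using X AB by auto
        then show ?thesis
          using gh uniq T_L by metis
      qed
      then show ?thesis
        using gh hit[OF gh(1) notP(1)] hit[OF gh(2) notP(2)] by blast
    qed
    have once: False
      if "E \<in> {C, D}" "X \<in> K - l - m" "Y \<in> K - l - m" "X \<noteq> Y"
        "g \<in> T" "X \<in> g" "A \<in> g" "E \<in> g" "h \<in> T" "Y \<in> h" "A \<in> h" "E \<in> h" for E X Y g h
    proof -
      have E: "E \<in> K" "E \<in> m" "E \<noteq> A"
        using that CDK AC by auto
      then have "g = h"
        using that uniq T_L by metis
      then show False
        using no_four[of g A E X Y] that E AK by auto
    qed
    obtain X Y Z where XYZ: "K - l - m = {X, Y, Z}" "X \<noteq> Y" "X \<noteq> Z" "Y \<noteq> Z"
      using rest by (auto simp: card_3_iff)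
    have in_rest: "X \<in> K - l - m" "Y \<in> K - l - m" "Z \<in> K - l - m"
      using XYZ by auto
    have CD_mem: "C \<in> {C, D}" "D \<in> {C, D}"
      by auto
    show False
      using through_A[OF in_rest(1)] through_A[OF in_rest(2)] through_A[OF in_rest(3)]
        XYZ(2-4) in_rest once[OF CD_mem(1)] once[OF CD_mem(2)] by metis
  qed
qed

section \<open>Points and lines of the projective plane\<close>

abbreviation point :: "'a::field ^ 3 \<Rightarrow> ('a ^ 3) set" where
  "point v \<equiv> vec.span {v}"

text \<open>
  A line is given by the coefficient vector of a linear form. The incidence axioms then come from the
  cross product, which works over any field: it gives the form that vanishes at two given points.
\<close>

definition line :: "'a::field ^ 3 \<Rightarrow> ('a ^ 3) set set" where
  "line u = {P \<in> proj_plane. \<forall>x\<in>P. scalar_product u x = 0}"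

definition lines :: "('a::field ^ 3) set set set" where
  "lines = line ` {u. u \<noteq> 0}"

definition cross :: "'a::field ^ 3 \<Rightarrow> 'a ^ 3 \<Rightarrow> 'a ^ 3" where
  "cross x y = vector [x $ 2 * y $ 3 - x $ 3 * y $ 2,
                       x $ 3 * y $ 1 - x $ 1 * y $ 3,
                       x $ 1 * y $ 2 - x $ 2 * y $ 1]"

lemma vec3_eq_iff: "(x :: 'a ^ 3) = y \<longleftrightarrow> x $ 1 = y $ 1 \<and> x $ 2 = y $ 2 \<and> x $ 3 = y $ 3"
  by (simp add: vec_eq_iff forall_3)

lemma point_eq_range: "point v = range (\<lambda>k. k *s v)"
  by (rule vec.span_singleton)

lemma point_scale:
  assumes "c \<noteq> 0"
  shows "point (c *s v) = point v"
proof
  show "point (c *s v) \<subseteq> point v"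
    by (auto simp: point_eq_range)
  show "point v \<subseteq> point (c *s v)"
  proof
    fix x assume "x \<in> point v"
    then obtain k where "x = k *s v"
      by (auto simp: point_eq_range)
    then have "x = (k / c) *s (c *s v)"
      using assms by simp
    then show "x \<in> point (c *s v)"
      unfolding point_eq_range by blast
  qed
qed

lemma point_in_plane: "v \<noteq> 0 \<Longrightarrow> point v \<in> proj_plane"
  by (auto simp: proj_plane_def)

lemma plane_cases:
  assumes "P \<in> proj_plane"
  obtains v where "v \<noteq> 0" "P = point v"
  using assms by (auto simp: proj_plane_def)

lemma scalar_product_scale:
  "scalar_product u (c *s x) = c * scalar_product (u :: 'a::field ^ 'n::finite) x"
  "scalar_product (c *s u) x = c * scalar_product u x"
  by (simp_all add: scalar_product_def sum_distrib_left mult_ac)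

lemma point_in_line_iff: "v \<noteq> 0 \<Longrightarrow> point v \<in> line u \<longleftrightarrow> scalar_product u v = 0"
  using vec.span_base[of v "{v}"] point_in_plane[of v]
  by (auto simp: line_def scalar_product_scale dest: subsetD[OF equalityD1[OF point_eq_range]])

lemma line_scale: "c \<noteq> 0 \<Longrightarrow> line (c *s u) = line u"
  by (simp add: line_def scalar_product_scale)

lemma parallel_if_cross_zero:
  assumes "cross x y = 0" "x \<noteq> 0"
  shows "\<exists>c. y = c *s x"
proof -
  have eqs: "x $ 2 * y $ 3 = x $ 3 * y $ 2" "x $ 3 * y $ 1 = x $ 1 * y $ 3"
      "x $ 1 * y $ 2 = x $ 2 * y $ 1"
    using assms(1) by (auto simp: cross_def vec3_eq_iff)
  consider "x $ 1 \<noteq> 0" | "x $ 2 \<noteq> 0" | "x $ 3 \<noteq> 0"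
    using assms(2) by (auto simp: vec3_eq_iff)
  then show ?thesis
  proof cases
    case 1
    then have "y = (y $ 1 / x $ 1) *s x"
      using eqs by (simp add: vec3_eq_iff field_simps)
    then show ?thesis ..
  next
    case 2
    then have "y = (y $ 2 / x $ 2) *s x"
      using eqs by (simp add: vec3_eq_iff field_simps)
    then show ?thesis ..
  next
    case 3
    then have "y = (y $ 3 / x $ 3) *s x"
      using eqs by (simp add: vec3_eq_iff field_simps)
    then show ?thesis ..
  qed
qed

lemma cross_nonzero_if_distinct_points:
  assumes "p \<noteq> 0" "q \<noteq> 0" "point p \<noteq> point q"
  shows "cross p q \<noteq> 0"
proof
  assume "cross p q = 0"
  then obtain c where "q = c *s p"
    using parallel_if_cross_zero assms by blast
  then show False
    using assms point_scale[of c p] by auto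
qed

text \<open>
  The cross product of \<open>p\<close> and \<open>q\<close> is orthogonal to both.
\<close>

lemma two_points_on_line:
  assumes "P \<in> proj_plane" "Q \<in> proj_plane" "P \<noteq> Q"
  shows "\<exists>l\<in>lines. P \<in> l \<and> Q \<in> l"
proof -
  obtain p where p: "p \<noteq> 0" "P = point p" using assms(1) by (rule plane_cases)
  obtain q where q: "q \<noteq> 0" "Q = point q" using assms(2) by (rule plane_cases)
  have "scalar_product (cross p q) p = 0" "scalar_product (cross p q) q = 0"
    by (simp_all add: cross_def scalar_product_def sum_3 algebra_simps)
  moreover have "cross p q \<noteq> 0"
    using cross_nonzero_if_distinct_points p q assms by blast
  ultimately show ?thesis
    using p q by (auto simp: lines_def point_in_line_iff)
qed

text \<open>
  The identity \<open>(p \<times> q) \<times> u = (u \<cdot> p) q - (u \<cdot> q) p\<close> shows that a form \<open>u\<close> that vanishes at \<open>p\<close> and \<open>q\<close> is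
  parallel to \<open>p \<times> q\<close>.
\<close>

lemma line_through_two_points_unique:
  assumes "l \<in> lines" "m \<in> lines" "P \<in> l" "P \<in> m" "Q \<in> l" "Q \<in> m" "P \<noteq> Q"
  shows "l = m"
proof -
  have "P \<in> proj_plane" "Q \<in> proj_plane"
    using assms by (auto simp: lines_def line_def)
  then obtain p q where pq: "p \<noteq> 0" "P = point p" "q \<noteq> 0" "Q = point q"
    by (auto elim!: plane_cases)
  have "k = line (cross p q)" if k: "k \<in> lines" "P \<in> k" "Q \<in> k" for k
  proof -
    obtain u where u: "u \<noteq> 0" "k = line u"
      using k by (auto simp: lines_def)
    have "scalar_product u p = 0" "scalar_product u q = 0"
      using k u pq by (auto simp: point_in_line_iff)
    moreover have "cross (cross p q) u = (scalar_product u p) *s q - (scalar_product u q) *s p"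
      by (simp add: cross_def scalar_product_def sum_3 vec3_eq_iff algebra_simps)
    ultimately have "cross (cross p q) u = 0"
      by simp
    moreover have "cross p q \<noteq> 0"
      using cross_nonzero_if_distinct_points pq assms by blast
    ultimately obtain c where "u = c *s cross p q"
      using parallel_if_cross_zero by blast
    then show ?thesis
      using u line_scale by (metis vec.scale_zero_left)
  qed
  then show ?thesis
    using assms by metis
qed

text \<open>
  Some coordinate of \<open>p\<close> is nonzero, and the equation \<open>u \<cdot> p = 0\<close> can be solved for that coordinate of
  \<open>u\<close>; the other two are free.
\<close>

lemma annihilator_spanned_by_two:
  assumes "p \<noteq> (0 :: 'a::field ^ 3)"
  shows "\<exists>a b. \<forall>u. scalar_product u p = 0 \<longrightarrow> (\<exists>s t. u = s *s a + t *s b)"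
proof -
  have solve: "z = - (x * r + y * s) / w"
    if "z * w + x * r + y * s = 0" "w \<noteq> 0" for x y z w r s :: 'a
    using that by (simp add: field_simps eq_neg_iff_add_eq_0)
  consider "p $ 1 \<noteq> 0" | "p $ 2 \<noteq> 0" | "p $ 3 \<noteq> 0"
    using assms by (auto simp: vec3_eq_iff)
  then show ?thesis
  proof cases
    case 1
    have "u = u $ 2 *s vector [- p $ 2 / p $ 1, 1, 0] + u $ 3 *s vector [- p $ 3 / p $ 1, 0, 1]"
      if "scalar_product u p = 0" for u
      using solve[of "u $ 1" "p $ 1" "u $ 2" "p $ 2" "u $ 3" "p $ 3"] that 1
      by (simp add: vec3_eq_iff scalar_product_def sum_3 algebra_simps diff_divide_distrib)
    then show ?thesis by blast
  next
    case 2
    have "u = u $ 1 *s vector [1, - p $ 1 / p $ 2, 0] + u $ 3 *s vector [0, - p $ 3 / p $ 2, 1]"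
      if "scalar_product u p = 0" for u
      using solve[of "u $ 2" "p $ 2" "u $ 1" "p $ 1" "u $ 3" "p $ 3"] that 2
      by (simp add: vec3_eq_iff scalar_product_def sum_3 algebra_simps diff_divide_distrib)
    then show ?thesis by blast
  next
    case 3
    have "u = u $ 1 *s vector [1, 0, - p $ 1 / p $ 3] + u $ 2 *s vector [0, 1, - p $ 2 / p $ 3]"
      if "scalar_product u p = 0" for u
      using solve[of "u $ 3" "p $ 3" "u $ 1" "p $ 1" "u $ 2" "p $ 2"] that 3
      by (simp add: vec3_eq_iff scalar_product_def sum_3 algebra_simps diff_divide_distrib)
    then show ?thesis by blast
  qed
qed

text \<open>
  The forms that vanish at \<open>P\<close> are \<open>s a + t b\<close> for two fixed forms \<open>a\<close>, \<open>b\<close>. Up to scaling such a form is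
  \<open>b\<close> or \<open>a + t b\<close>, with one choice of \<open>t\<close> for every element of the field.
\<close>

lemma card_lines_through_point:
  fixes P :: "('a::{field,finite} ^ 3) set"
  assumes "P \<in> proj_plane"
  shows "card {l \<in> lines. P \<in> l} \<le> CARD('a) + 1"
proof -
  obtain p where p: "p \<noteq> 0" "P = point p" using assms by (rule plane_cases)
  obtain a b where ab: "\<And>u. scalar_product u p = 0 \<Longrightarrow> \<exists>s t. u = s *s a + t *s b"
    using annihilator_spanned_by_two[OF p(1)] by blast
  have "{l \<in> lines. P \<in> l} \<subseteq> insert (line b) (range (\<lambda>t. line (a + t *s b)))"
  proof
    fix l assume l: "l \<in> {l \<in> lines. P \<in> l}"
    then obtain u where u: "u \<noteq> 0" "l = line u"
      by (auto simp: lines_def)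
    then have "scalar_product u p = 0"
      using l p by (simp add: point_in_line_iff)
    then obtain s t where st: "u = s *s a + t *s b"
      using ab by blast
    show "l \<in> insert (line b) (range (\<lambda>t. line (a + t *s b)))"
    proof (cases "s = 0")
      case True
      then have "t \<noteq> 0" "u = t *s b"
        using u st by auto
      then show ?thesis
        using u(2) line_scale[of t b] by simp
    next
      case False
      then have u': "u = s *s (a + (t / s) *s b)"
        using st by (simp add: vec.scale_right_distrib)
      then have "l = line (a + (t / s) *s b)"
        unfolding u(2) u' using False by (intro line_scale)
      then show ?thesis
        by simp
    qed
  qed
  then have "card {l \<in> lines. P \<in> l} \<le> card (insert (line b) (range (\<lambda>t. line (a + t *s b))))"
    by (intro card_mono) auto
  also have "\<dots> \<le> card (range (\<lambda>t. line (a + t *s b))) + 1"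
    using card_insert_le_m1 by (simp add: card_insert_if)
  also have "\<dots> \<le> CARD('a) + 1"
    by (simp add: card_image_le)
  finally show ?thesis .
qed

text \<open>
  The conic is given by the product of the two linear forms, which is not the zero form because
  polynomials over a field have no zero divisors.
\<close>

lemma conic_line_pair:
  assumes "l \<in> lines" "m \<in> lines"
  shows "conic (l \<union> m)"
proof -
  obtain u v where uv: "u \<noteq> 0" "l = line u" "v \<noteq> 0" "m = line v"
    using assms by (auto simp: lines_def)
  define Q where "Q = quad_form (u$1 * v$1) (u$2 * v$2) (u$3 * v$3)
     (u$1 * v$2 + u$2 * v$1) (u$1 * v$3 + u$3 * v$1) (u$2 * v$3 + u$3 * v$2)"
  have Q: "Q x = (scalar_product u x) * (scalar_product v x)" for x
    by (simp add: Q_def quad_form_def scalar_product_def sum_3 power2_eq_square algebra_simps)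
  have "P \<in> l \<union> m \<longleftrightarrow> P \<in> {P \<in> proj_plane. \<forall>x\<in>P. Q x = 0}" for P
  proof (cases "P \<in> proj_plane")
    case True
    then obtain p where p: "p \<noteq> 0" "P = point p" by (rule plane_cases)
    have "p \<in> P"
      using p vec.span_base by blast
    then have "(\<forall>x\<in>P. Q x = 0) \<longleftrightarrow> Q p = 0"
      unfolding p(2) point_eq_range by (auto simp: Q scalar_product_scale)
    then show ?thesis
      using True p uv by (simp add: Q point_in_line_iff)
  next
    case False
    then show ?thesis
      using uv by (auto simp: line_def)
  qed
  then have "l \<union> m = {P \<in> proj_plane. \<forall>x\<in>P. Q x = 0}"
    by blast
  moreover have "\<not> (u$1 * v$1 = 0 \<and> u$2 * v$2 = 0 \<and> u$3 * v$3 = 0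
     \<and> u$1 * v$2 + u$2 * v$1 = 0 \<and> u$1 * v$3 + u$3 * v$1 = 0 \<and> u$2 * v$3 + u$3 * v$2 = 0)"
    using uv(1,3) by (auto simp: vec3_eq_iff)
  ultimately show ?thesis
    unfolding conic_def Q_def by blast
qed

section \<open>The Fano subplane\<close>

text \<open>
  These seven vectors represent seven different points: the only scalar between two of them is 1.
  Working with the representatives turns statements about the Fano subplane into evaluations.
\<close>

definition fano :: "('a::field ^ 3) set" where
  "fano = {v. v \<noteq> 0 \<and> (\<forall>i. v $ i \<in> {0, 1})}"

lemma fano_eq:
  "fano = set [vector [1,0,0], vector [0,1,0], vector [0,0,1], vector [1,1,0],
               vector [1,0,1], vector [0,1,1], vector [1,1,1]]"
  by (auto simp: fano_def vec3_eq_iff forall_3)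

lemma card_fano: "card (fano :: ('a::field ^ 3) set) = 7"
  unfolding fano_eq by (subst distinct_card) (auto simp: vec3_eq_iff)

lemma inj_on_point_fano: "inj_on point fano"
proof
  fix v w :: "'a ^ 3"
  assume v: "v \<in> fano" and w: "w \<in> fano" and "point v = point w"
  then have "v \<in> point w"
    using vec.span_base by blast
  then obtain c where c: "v = c *s w"
    by (auto simp: point_eq_range)
  obtain i where "v $ i \<noteq> 0"
    using v by (auto simp: fano_def vec_eq_iff)
  then have "c = 1"
    using v w c by (auto simp: fano_def) (metis mult_cancel_left1)
  then show "v = w"
    using c by simp
qed

text \<open>
  The coefficient of a square is counted at the four vectors with that coordinate 1, the coefficient of
  a mixed term at the two vectors with both coordinates 1; all these numbers are even.
\<close>

lemma quad_form_sum_fano: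
  assumes "(1::'a::field) + 1 = 0"
  shows "(\<Sum>v\<in>fano. quad_form a b c d e f v) = (0::'a)"
proof -
  have eq: "(\<Sum>v\<in>fano. quad_form a b c d e f v) = (1 + 1) * (a + a + b + b + c + c + d + e + f)"
    unfolding fano_eq
    by (subst sum.distinct_set_conv_list) (simp_all add: vec3_eq_iff quad_form_def algebra_simps)
  show ?thesis
    by (simp only: eq assms mult_zero_left)
qed

text \<open>
  The unit vectors give the coefficients of the squares, and the sums of two unit vectors then give the
  mixed ones.
\<close>

lemma quad_form_zero_on_fano:
  assumes "\<And>v. v \<in> fano \<Longrightarrow> quad_form a b c d e f v = (0::'a::field)"
  shows "a = 0 \<and> b = 0 \<and> c = 0 \<and> d = 0 \<and> e = 0 \<and> f = 0"
proof -
  have sq: "a = 0" "b = 0" "c = 0"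
    using assms[of "vector [1,0,0]"] assms[of "vector [0,1,0]"] assms[of "vector [0,0,1]"]
    by (simp_all add: fano_eq quad_form_def)
  moreover have "d = 0" "e = 0" "f = 0"
    using assms[of "vector [1,1,0]"] assms[of "vector [1,0,1]"] assms[of "vector [0,1,1]"] sq
    by (simp_all add: fano_eq quad_form_def)
  ultimately show ?thesis
    by simp
qed

text \<open>
  A conic through six of the seven points contains the seventh as well, because the seven values of its
  form add up to zero.
\<close>

lemma generalized_arc_fano:
  assumes "(1::'a::field) + 1 = 0"
  shows "generalized_arc 7 (point ` (fano :: ('a ^ 3) set))"
proof -
  have fin: "finite (fano :: ('a ^ 3) set)"
    by (simp add: fano_eq)
  have False if S: "S \<subseteq> point ` (fano :: ('a ^ 3) set)" "card S = 6" "conic C" "S \<subseteq> C" for S C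
  proof -
    obtain a b c d e f where nz: "\<not> (a = 0 \<and> b = 0 \<and> c = 0 \<and> d = 0 \<and> e = 0 \<and> f = 0)"
      and C: "C = {P \<in> proj_plane. \<forall>x\<in>P. quad_form a b c d e f x = 0}"
      using S(3) unfolding conic_def by blast
    obtain V where V: "V \<subseteq> fano" "S = point ` V"
      using S(1) by (meson subset_imageE)
    have "card V = 6"
      using S(2) V inj_on_point_fano by (metis card_image inj_on_subset)
    then have "card (fano - V) = 1"
      using V fin card_fano[where 'a = 'a] by (subst card_Diff_subset) (auto intro: finite_subset)
    then obtain w where w: "fano - V = {w}"
      by (auto simp: card_1_singleton_iff)
    have on_V: "quad_form a b c d e f v = 0" if "v \<in> V" for v
    proof -
      have "point v \<in> C"
        using V S(4) that by auto
      then show ?thesis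
        using C vec.span_base[of v "{v}"] by auto
    qed
    have "(\<Sum>v\<in>fano. quad_form a b c d e f v) = (\<Sum>v\<in>{w}. quad_form a b c d e f v)"
      using fin w on_V by (intro sum.mono_neutral_right) auto
    then have "quad_form a b c d e f w = 0"
      using quad_form_sum_fano[OF assms, of a b c d e f] by simp
    moreover have "v \<in> V \<or> v = w" if "v \<in> fano" for v
      using w that by blast
    ultimately have "quad_form a b c d e f v = 0" if "v \<in> fano" for v
      using on_V that by blast
    then show False
      using quad_form_zero_on_fano nz by blast
  qed
  moreover have "point ` fano \<subseteq> proj_plane"
    by (auto simp: fano_def point_in_plane)
  ultimately show ?thesis
    using fin card_fano[where 'a = 'a] inj_on_point_fano[where 'a = 'a]
    unfolding generalized_arc_def by (auto simp: card_image)
qed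

lemma generalized_arc_subset:
  assumes "generalized_arc k K" "J \<subseteq> K"
  shows "generalized_arc (card J) J"
proof -
  have "J \<subseteq> proj_plane" "finite J"
    using assms by (auto simp: generalized_arc_def intro: finite_subset)
  moreover have "\<not> (\<exists>S C. S \<subseteq> J \<and> card S = 6 \<and> conic C \<and> S \<subseteq> C)"
    using assms unfolding generalized_arc_def by (metis subset_trans)
  ultimately show ?thesis
    by (simp add: generalized_arc_def)
qed

lemma two_eq_zero_if_card_four:
  assumes "CARD('a::{field,finite}) = 4"
  shows "(1::'a) + 1 = 0"
proof -
  have "of_nat 4 = (0::'a)"
    using CHAR_dvd_CARD[where 'a='a] assms of_nat_eq_0_iff_char_dvd by metis
  moreover have "of_nat 4 = ((1::'a) + 1) * (1 + 1)"
    by simp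
  ultimately show ?thesis
    by (metis mult_eq_0_iff)
qed

section \<open>The largest generalized arc in the plane of order four\<close>

lemma no_generalized_arc_of_eight:
  fixes K :: "('a::{field,finite} ^ 3) set set"
  assumes q: "CARD('a) = 4"
  shows "\<not> generalized_arc 8 K"
proof
  assume arc: "generalized_arc 8 K"
  then have K: "K \<subseteq> proj_plane" "card K = 8"
    by (auto simp: generalized_arc_def)
  have "\<exists>l\<in>lines. \<exists>m\<in>lines. 6 \<le> card (K \<inter> (l \<union> m))"
  proof (rule two_lines_cover_six_of_eight[OF K(2)])
    show "\<exists>l\<in>lines. P \<in> l \<and> Q \<in> l" if "P \<in> K" "Q \<in> K" "P \<noteq> Q" for P Q
      using two_points_on_line that K(1) by blast
    show "l = m" if "l \<in> lines" "m \<in> lines" "P \<in> l" "P \<in> m" "Q \<in> l" "Q \<in> m" "P \<noteq> Q"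
      for l m :: "('a ^ 3) set set" and P Q
      using line_through_two_points_unique that by blast
    show "finite {l \<in> lines. P \<in> l}" for P :: "('a ^ 3) set"
      by simp
    show "card {l \<in> lines. P \<in> l} \<le> 5" if "P \<in> K" for P
      using card_lines_through_point[of P] that K(1) q by auto
  qed
  then obtain l m where lm: "l \<in> lines" "m \<in> lines" "6 \<le> card (K \<inter> (l \<union> m))"
    by blast
  then obtain S where "S \<subseteq> K \<inter> (l \<union> m)" "card S = 6"
    by (meson obtain_subset_with_card_n)
  moreover have "conic (l \<union> m)"
    using lm(1,2) by (rule conic_line_pair)
  ultimately show False
    using arc unfolding generalized_arc_def by blast
qed

lemma generalized_arc_at_most_seven:
  fixes K :: "('a::{field,finite} ^ 3) set set"
  assumes "CARD('a) = 4" "generalized_arc k K"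
  shows "k \<le> 7"
proof (rule ccontr)
  assume "\<not> k \<le> 7"
  then have "8 \<le> card K"
    using assms(2) by (simp add: generalized_arc_def)
  then obtain J where "J \<subseteq> K" "card J = 8"
    by (meson obtain_subset_with_card_n)
  then show False
    using generalized_arc_subset[OF assms(2)] no_generalized_arc_of_eight[OF assms(1)] by metis
qed

theorem proposition4:
  assumes "CARD('a::{field,finite}) = 4"
  shows "m_g TYPE('a) = 7"
proof -
  let ?sizes = "{k. \<exists>K :: ('a ^ 3) set set. complete_generalized_arc k K}"
  have bound: "k \<le> 7" if "generalized_arc k K" for k and K :: "('a ^ 3) set set"
    using generalized_arc_at_most_seven[OF assms that] .
  have "generalized_arc 7 (point ` (fano :: ('a ^ 3) set))"
    using generalized_arc_fano two_eq_zero_if_card_four[OF assms] by blast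
  moreover have "\<not> generalized_arc (7 + 1) L" for L :: "('a ^ 3) set set"
    using bound[of "7 + 1" L] by auto
  ultimately have seven: "7 \<in> ?sizes"
    unfolding complete_generalized_arc_def by blast
  have upper: "k \<le> 7" if "k \<in> ?sizes" for k
  proof -
    obtain K :: "('a ^ 3) set set" where "generalized_arc k K"
      using \<open>k \<in> ?sizes\<close> by (auto simp: complete_generalized_arc_def)
    then show ?thesis
      by (rule bound)
  qed
  have "?sizes \<subseteq> {..7}"
    using upper by (intro subsetI) (simp only: atMost_iff)
  then have fin: "finite ?sizes"
    by (rule finite_subset) simp
  show ?thesis
    unfolding m_g_def using fin upper seven by (rule Max_eqI)
qed

end
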